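(* Let $\gamma_1,\gamma_2:\mathcal{Z}\to[0,\infty)$ be measurable functions, and let $\alpha_1,\alpha_2>0$ satisfy $\frac1{\alpha_1}+\frac1{\alpha_2}=1$. Then for every measurable function $\Psi:\mathcal{Z}\to(0,\infty)$, $$\|\gamma_1\gamma_2\|_1\;\le\;\|\gamma_1\Psi\|_{\alpha_1}\,\|\gamma_2/\Psi\|_{\alpha_2}.$$ Moreover, equality holds if, for almost all $z\in\mathcal{Z}$, $\gamma_1(z)>0$ and $\Psi(z)=\gamma_1(z)^{-\frac1{\alpha_2}}\,\gamma_2(z)^{\frac1{\alpha_1}}$.
   Context: $(\Omega,\mathcal{F},\nu)$ is a probability space and $Z$ is a random variable on it with values in a Hilbert space $\mathcal{Z}$ (with its Borel $\sigma$-algebra). For a measurable $f:\mathcal{Z}\to\mathbb{R}$ and $1\le p<\infty$, $\|f\|_p:=\left(\int |f(Z)|^p\,d\nu\right)^{1/p}\in[0,\infty]$, with the convention $0\cdot\infty=0$. "Almost all $z$" refers to the law of $Z$ on $\mathcal{Z}$. *)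

theory Defs
  imports "HOL-Probability.Probability"
begin

(* Powers t^a on [0, \<infinity>], used only for a > 0: hence \<infinity>^a = \<infinity>, and 0^a = 0 because
   0 powr a = 0. *)
definition ennreal_powr :: "ennreal \<Rightarrow> real \<Rightarrow> ennreal" where
  "ennreal_powr t a = (if t = \<infinity> then \<infinity> else ennreal (enn2real t powr a))"

(* Takes values in [0, \<infinity>]; meant for 1 \<le> p. The convention 0 * \<infinity> = 0 for products of such
   norms is the one built into ennreal. *)
definition Lp_norm :: "'w measure \<Rightarrow> ('w \<Rightarrow> 'z) \<Rightarrow> real \<Rightarrow> ('z \<Rightarrow> real) \<Rightarrow> ennreal" where
  "Lp_norm \<nu> Z p f =
     ennreal_powr (\<integral>\<^sup>+ \<omega>. ennreal (\<bar>f (Z \<omega>)\<bar> powr p) \<partial>\<nu>) (1 / p)"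

end

(* Hoelder's inequality, applied to \<gamma>\<^sub>1 \<Psi> and \<gamma>\<^sub>2 / \<Psi>, is Young's inequality integrated after normalising
   both factors. The choice \<Psi> = \<gamma>\<^sub>1 powr (-1/\<alpha>\<^sub>2) * \<gamma>\<^sub>2 powr (1/\<alpha>\<^sub>1) makes (\<gamma>\<^sub>1 \<Psi>) powr \<alpha>\<^sub>1 and
   (\<gamma>\<^sub>2 / \<Psi>) powr \<alpha>\<^sub>2 both equal to \<gamma>\<^sub>1 \<gamma>\<^sub>2 almost everywhere, so that the right-hand side becomes
   I powr (1/\<alpha>\<^sub>1) * I powr (1/\<alpha>\<^sub>2) = I, where I is the integral of \<gamma>\<^sub>1 \<gamma>\<^sub>2. *)
theory Submission
  imports Defs
begin

lemma ennreal_powr_eq_0_iff: "ennreal_powr t a = 0 \<longleftrightarrow> t = 0"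
  by (cases t) (auto simp: ennreal_powr_def ennreal_eq_0_iff)

lemma ennreal_powr_eq_top_iff: "ennreal_powr t a = \<infinity> \<longleftrightarrow> t = \<infinity>"
  by (simp add: ennreal_powr_def)

lemma ennreal_powr_ennreal: "0 \<le> x \<Longrightarrow> ennreal_powr (ennreal x) a = ennreal (x powr a)"
  by (simp add: ennreal_powr_def)

lemma ennreal_powr_1: "ennreal_powr t 1 = t"
  by (cases t) (simp_all add: ennreal_powr_def)

text \<open>For finite \<open>t\<close> this is \<open>powr_add\<close>; at infinity both sides are
  infinite. It later merges the two norms when the underlying integrals coincide, whether or not
  that integral is finite.\<close>

lemma ennreal_powr_add: "ennreal_powr t a * ennreal_powr t b = ennreal_powr t (a + b)"
  by (cases t) (simp_all add: ennreal_powr_def powr_add ennreal_mult ennreal_top_mult)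

lemma conjugate_exponents_gt_1:
  fixes p q :: real
  assumes "0 < p" "0 < q" "1 / p + 1 / q = 1"
  shows "1 < p" and "1 < q"
proof -
  have "0 < 1 / p" "0 < 1 / q" using assms by simp_all
  then have "1 / p < 1" "1 / q < 1" using assms(3) by linarith+
  then show "1 < p" "1 < q" using assms by simp_all
qed

text \<open>Young's inequality for \<open>u / A\<close> and \<open>v / B\<close>, where
  \<open>A powr p = a\<close> and \<open>B powr q = b\<close>, multiplied by \<open>A * B\<close>.
  The numbers \<open>a\<close> and \<open>b\<close> are to be the integrals of the two powers, so
  that each normalised power integrates to 1.\<close>

lemma Youngs_inequality_scaled:
  fixes p q a b u v :: real
  assumes "1 < p" "1 < q" "1 / p + 1 / q = 1" "0 < a" "0 < b" "0 \<le> u" "0 \<le> v"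
  shows "u * v \<le> a powr (1 / p) * b powr (1 / q) * (u powr p / (p * a) + v powr q / (q * b))"
proof -
  define A B where "A = a powr (1 / p)" and "B = b powr (1 / q)"
  have pos: "0 < A" "0 < B" using assms by (simp_all add: A_def B_def)
  have pow: "A powr p = a" "B powr q = b" using assms by (simp_all add: A_def B_def powr_powr)
  have "(u / A) * (v / B) \<le> (u / A) powr p / p + (v / B) powr q / q"
    using assms pos by (intro Youngs_inequality) simp_all
  also have "\<dots> = u powr p / (p * a) + v powr q / (q * b)"
    using assms pos pow by (simp add: powr_divide mult.commute)
  finally have "A * B * ((u / A) * (v / B)) \<le> A * B * (u powr p / (p * a) + v powr q / (q * b))"
    using pos by (intro mult_left_mono) simp_all
  then show ?thesis using pos by (simp add: A_def B_def)
qed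

text \<open>Normalising needs both integrals positive and finite, so the values 0 and infinity are
  settled first.\<close>

lemma nn_integral_Hoelder:
  fixes f g :: "'a \<Rightarrow> real"
  assumes [measurable]: "f \<in> borel_measurable M" "g \<in> borel_measurable M"
    and exps: "1 < p" "1 < q" "1 / p + 1 / q = 1"
  shows "(\<integral>\<^sup>+x. ennreal \<bar>f x * g x\<bar> \<partial>M)
    \<le> ennreal_powr (\<integral>\<^sup>+x. ennreal (\<bar>f x\<bar> powr p) \<partial>M) (1 / p)
      * ennreal_powr (\<integral>\<^sup>+x. ennreal (\<bar>g x\<bar> powr q) \<partial>M) (1 / q)"
    (is "?L \<le> ennreal_powr ?F _ * ennreal_powr ?G _")
proof -
  consider "?F = 0 \<or> ?G = 0" | "?F \<noteq> 0" "?G \<noteq> 0" "?F = \<infinity> \<or> ?G = \<infinity>"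
    | "?F \<noteq> 0" "?G \<noteq> 0" "?F \<noteq> \<infinity>" "?G \<noteq> \<infinity>" by blast
  then show ?thesis
  proof cases
    case 1
    \<comment> \<open>If one integral is 0, the right-hand side is 0 even when the other is
      infinite, so the left-hand side must vanish too: one of the factors is 0 almost
      everywhere.\<close>
    then have "AE x in M. f x * g x = 0"
    proof
      assume "?F = 0"
      then have "AE x in M. ennreal (\<bar>f x\<bar> powr p) = 0"
        by (subst (asm) nn_integral_0_iff_AE) simp_all
      then show ?thesis by eventually_elim (simp add: ennreal_eq_0_iff)
    next
      assume "?G = 0"
      then have "AE x in M. ennreal (\<bar>g x\<bar> powr q) = 0"
        by (subst (asm) nn_integral_0_iff_AE) simp_all
      then show ?thesis by eventually_elim (simp add: ennreal_eq_0_iff)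
    qed
    then have "?L = 0"
      by (subst nn_integral_0_iff_AE) (simp_all add: ennreal_eq_0_iff)
    then show ?thesis by simp
  next
    case 2
    \<comment> \<open>An infinite factor times a nonzero one is infinite, so the bound is
      trivial.\<close>
    then have "ennreal_powr ?F (1 / p) * ennreal_powr ?G (1 / q) = \<infinity>"
      using ennreal_powr_eq_0_iff ennreal_powr_eq_top_iff
      by (auto simp: ennreal_mult_eq_top_iff)
    then show ?thesis by simp
  next
    case 3
    then obtain a b where a: "?F = ennreal a" "0 < a" and b: "?G = ennreal b" "0 < b"
      by (cases ?F; cases ?G) (auto simp: less_le)
    \<comment> \<open>\<open>C\<close> is the right-hand side of the claim. Integrating the scaled
      Young inequality cancels \<open>a\<close> and \<open>b\<close> and leaves
      \<open>C * (1 / p + 1 / q) = C\<close>.\<close>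
    define C where "C = a powr (1 / p) * b powr (1 / q)"
    have C: "0 \<le> C" by (simp add: C_def)
    have "?L \<le> (\<integral>\<^sup>+x. ennreal (C / (p * a)) * ennreal (\<bar>f x\<bar> powr p)
                  + ennreal (C / (q * b)) * ennreal (\<bar>g x\<bar> powr q) \<partial>M)"
    proof (rule nn_integral_mono)
      fix x
      have "\<bar>f x * g x\<bar> \<le> C / (p * a) * \<bar>f x\<bar> powr p + C / (q * b) * \<bar>g x\<bar> powr q"
        using Youngs_inequality_scaled[OF exps a(2) b(2), of "\<bar>f x\<bar>" "\<bar>g x\<bar>"]
        by (simp add: abs_mult C_def distrib_left)
      then show "ennreal \<bar>f x * g x\<bar> \<le> ennreal (C / (p * a)) * ennreal (\<bar>f x\<bar> powr p)
                  + ennreal (C / (q * b)) * ennreal (\<bar>g x\<bar> powr q)"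
        using C a b exps
        by (simp add: ennreal_mult[symmetric] ennreal_plus[symmetric] del: ennreal_plus)
    qed
    also have "\<dots> = ennreal (C / (p * a)) * ?F + ennreal (C / (q * b)) * ?G"
      by (simp add: nn_integral_add nn_integral_cmult)
    also have "\<dots> = ennreal (C / (p * a) * a + C / (q * b) * b)"
      using C a b exps
      by (simp add: ennreal_mult[symmetric] ennreal_plus[symmetric] del: ennreal_plus)
    also have "C / (p * a) * a + C / (q * b) * b = C * (1 / p + 1 / q)"
      using a b exps(1,2) by (simp add: distrib_left)
    also have "\<dots> = C" using exps by simp
    also have "ennreal C = ennreal_powr ?F (1 / p) * ennreal_powr ?G (1 / q)"
      using a b by (simp add: ennreal_powr_ennreal C_def ennreal_mult)
    finally show ?thesis .
  qed
qed

text \<open>The exponents of \<open>s\<close> balance the two factors: as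
  \<open>1 - 1 / q = 1 / p\<close> and \<open>1 - 1 / p = 1 / q\<close>, one gets
  \<open>x * s = (x * y) powr (1 / p)\<close> and
  \<open>y / s = (x * y) powr (1 / q)\<close>.\<close>

lemma conjugate_weight_powr:
  fixes p q x y s :: real
  assumes "0 < p" "0 < q" "1 / p + 1 / q = 1" "0 < x" "0 \<le> y"
    and s: "s = x powr (- (1 / q)) * y powr (1 / p)"
  shows "(x * s) powr p = x * y" and "0 < s \<Longrightarrow> (y / s) powr q = x * y"
proof -
  have p: "1 / p = 1 + - (1 / q)" and q: "1 / q = 1 + - (1 / p)" using assms(3) by simp_all
  have "x * s = (x powr 1 * x powr (- (1 / q))) * y powr (1 / p)"
    using assms by simp
  also have "\<dots> = x powr (1 / p) * y powr (1 / p)"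
    by (simp only: powr_add[symmetric] p)
  also have "\<dots> = (x * y) powr (1 / p)"
    using assms by (simp add: powr_mult)
  finally show "(x * s) powr p = x * y"
    using assms by (simp add: powr_powr)
  assume "0 < s"
  \<comment> \<open>For \<open>y = 0\<close> the weight \<open>s\<close> would be 0, because
    \<open>0 powr (1 / p) = 0\<close>.\<close>
  then have y: "0 < y" using assms by (cases "y = 0") simp_all
  have "y / s = (y powr 1 * y powr (- (1 / p))) * x powr (1 / q)"
    using assms y by (simp add: powr_minus divide_inverse)
  also have "\<dots> = y powr (1 / q) * x powr (1 / q)"
    by (simp only: powr_add[symmetric] q)
  also have "\<dots> = (x * y) powr (1 / q)"
    using assms y by (simp add: powr_mult)
  finally show "(y / s) powr q = x * y"
    using assms by (simp add: powr_powr)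
qed

theorem theorem1:
  fixes \<nu> :: "'w measure"
    and Z :: "'w \<Rightarrow> 'z::{real_inner, complete_space}"
    and \<gamma>\<^sub>1 \<gamma>\<^sub>2 :: "'z \<Rightarrow> real"
    and \<alpha>\<^sub>1 \<alpha>\<^sub>2 :: real
  assumes "prob_space \<nu>"
    and "Z \<in> borel_measurable \<nu>"
    and "\<gamma>\<^sub>1 \<in> borel_measurable borel" and "\<And>z. 0 \<le> \<gamma>\<^sub>1 z"
    and "\<gamma>\<^sub>2 \<in> borel_measurable borel" and "\<And>z. 0 \<le> \<gamma>\<^sub>2 z"
    and "0 < \<alpha>\<^sub>1" and "0 < \<alpha>\<^sub>2" and "1 / \<alpha>\<^sub>1 + 1 / \<alpha>\<^sub>2 = 1"
  shows "\<forall>\<Psi> :: 'z \<Rightarrow> real. \<Psi> \<in> borel_measurable borel \<longrightarrow> (\<forall>z. 0 < \<Psi> z) \<longrightarrow>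
    Lp_norm \<nu> Z 1 (\<lambda>z. \<gamma>\<^sub>1 z * \<gamma>\<^sub>2 z)
      \<le> Lp_norm \<nu> Z \<alpha>\<^sub>1 (\<lambda>z. \<gamma>\<^sub>1 z * \<Psi> z) * Lp_norm \<nu> Z \<alpha>\<^sub>2 (\<lambda>z. \<gamma>\<^sub>2 z / \<Psi> z) \<and>
    ((AE z in distr \<nu> borel Z.
        0 < \<gamma>\<^sub>1 z \<and> \<Psi> z = \<gamma>\<^sub>1 z powr (- (1 / \<alpha>\<^sub>2)) * \<gamma>\<^sub>2 z powr (1 / \<alpha>\<^sub>1)) \<longrightarrow>
      Lp_norm \<nu> Z 1 (\<lambda>z. \<gamma>\<^sub>1 z * \<gamma>\<^sub>2 z)
        = Lp_norm \<nu> Z \<alpha>\<^sub>1 (\<lambda>z. \<gamma>\<^sub>1 z * \<Psi> z) * Lp_norm \<nu> Z \<alpha>\<^sub>2 (\<lambda>z. \<gamma>\<^sub>2 z / \<Psi> z))"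
proof (intro allI impI conjI)
  fix \<Psi> :: "'z \<Rightarrow> real"
  assume meas[measurable]: "\<Psi> \<in> borel_measurable borel" and "\<forall>z. 0 < \<Psi> z"
  then have \<Psi>: "0 < \<Psi> z" for z by simp
  note [measurable] = assms(2,3,5)
  note exps = assms(7-9)
  have L: "Lp_norm \<nu> Z 1 (\<lambda>z. \<gamma>\<^sub>1 z * \<gamma>\<^sub>2 z) = (\<integral>\<^sup>+\<omega>. ennreal (\<gamma>\<^sub>1 (Z \<omega>) * \<gamma>\<^sub>2 (Z \<omega>)) \<partial>\<nu>)"
    using assms(4,6) by (simp add: Lp_norm_def ennreal_powr_1)
  \<comment> \<open>Positivity of \<Psi> lets the weight cancel, so the left-hand side of Hoelder's
    inequality is the integral of \<open>\<gamma>\<^sub>1 * \<gamma>\<^sub>2\<close>.\<close>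
  have "(\<gamma>\<^sub>1 z * \<Psi> z) * (\<gamma>\<^sub>2 z / \<Psi> z) = \<gamma>\<^sub>1 z * \<gamma>\<^sub>2 z" for z
    using \<Psi>[of z] by simp
  then show "Lp_norm \<nu> Z 1 (\<lambda>z. \<gamma>\<^sub>1 z * \<gamma>\<^sub>2 z)
      \<le> Lp_norm \<nu> Z \<alpha>\<^sub>1 (\<lambda>z. \<gamma>\<^sub>1 z * \<Psi> z) * Lp_norm \<nu> Z \<alpha>\<^sub>2 (\<lambda>z. \<gamma>\<^sub>2 z / \<Psi> z)"
    using nn_integral_Hoelder[of "\<lambda>\<omega>. \<gamma>\<^sub>1 (Z \<omega>) * \<Psi> (Z \<omega>)" \<nu> "\<lambda>\<omega>. \<gamma>\<^sub>2 (Z \<omega>) / \<Psi> (Z \<omega>)" \<alpha>\<^sub>1 \<alpha>\<^sub>2]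
      conjugate_exponents_gt_1[OF exps] exps assms(4,6)
    unfolding L by (simp add: Lp_norm_def)
  assume "AE z in distr \<nu> borel Z.
        0 < \<gamma>\<^sub>1 z \<and> \<Psi> z = \<gamma>\<^sub>1 z powr (- (1 / \<alpha>\<^sub>2)) * \<gamma>\<^sub>2 z powr (1 / \<alpha>\<^sub>1)"
  \<comment> \<open>The hypothesis concerns the law of \<open>Z\<close>; it is pulled back along
    \<open>Z\<close> because the norms integrate over \<nu>.\<close>
  then have ae: "AE \<omega> in \<nu>. 0 < \<gamma>\<^sub>1 (Z \<omega>)
        \<and> \<Psi> (Z \<omega>) = \<gamma>\<^sub>1 (Z \<omega>) powr (- (1 / \<alpha>\<^sub>2)) * \<gamma>\<^sub>2 (Z \<omega>) powr (1 / \<alpha>\<^sub>1)"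
    by (rule AE_distrD[OF assms(2)])
  let ?I = "\<integral>\<^sup>+\<omega>. ennreal (\<gamma>\<^sub>1 (Z \<omega>) * \<gamma>\<^sub>2 (Z \<omega>)) \<partial>\<nu>"
  have "AE \<omega> in \<nu>. ennreal (\<bar>\<gamma>\<^sub>1 (Z \<omega>) * \<Psi> (Z \<omega>)\<bar> powr \<alpha>\<^sub>1) = ennreal (\<gamma>\<^sub>1 (Z \<omega>) * \<gamma>\<^sub>2 (Z \<omega>))"
    using ae
  proof eventually_elim
    case (elim \<omega>)
    then show ?case
      using conjugate_weight_powr(1)[OF exps _ assms(6), of "\<gamma>\<^sub>1 (Z \<omega>)" "\<Psi> (Z \<omega>)" "Z \<omega>"]
        \<Psi>[of "Z \<omega>"] by (simp add: abs_mult)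
  qed
  then have 1: "(\<integral>\<^sup>+\<omega>. ennreal (\<bar>\<gamma>\<^sub>1 (Z \<omega>) * \<Psi> (Z \<omega>)\<bar> powr \<alpha>\<^sub>1) \<partial>\<nu>) = ?I"
    by (rule nn_integral_cong_AE)
  have "AE \<omega> in \<nu>. ennreal (\<bar>\<gamma>\<^sub>2 (Z \<omega>) / \<Psi> (Z \<omega>)\<bar> powr \<alpha>\<^sub>2) = ennreal (\<gamma>\<^sub>1 (Z \<omega>) * \<gamma>\<^sub>2 (Z \<omega>))"
    using ae
  proof eventually_elim
    case (elim \<omega>)
    then show ?case
      \<comment> \<open>The premise \<open>0 < s\<close> comes from \<Psi> being positive
        everywhere.\<close>
      using conjugate_weight_powr(2)[OF exps _ assms(6), of "\<gamma>\<^sub>1 (Z \<omega>)" "\<Psi> (Z \<omega>)" "Z \<omega>"]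
        \<Psi>[of "Z \<omega>"] assms(6)[of "Z \<omega>"] by simp
  qed
  then have 2: "(\<integral>\<^sup>+\<omega>. ennreal (\<bar>\<gamma>\<^sub>2 (Z \<omega>) / \<Psi> (Z \<omega>)\<bar> powr \<alpha>\<^sub>2) \<partial>\<nu>) = ?I"
    by (rule nn_integral_cong_AE)
  show "Lp_norm \<nu> Z 1 (\<lambda>z. \<gamma>\<^sub>1 z * \<gamma>\<^sub>2 z)
      = Lp_norm \<nu> Z \<alpha>\<^sub>1 (\<lambda>z. \<gamma>\<^sub>1 z * \<Psi> z) * Lp_norm \<nu> Z \<alpha>\<^sub>2 (\<lambda>z. \<gamma>\<^sub>2 z / \<Psi> z)"
    \<comment> \<open>Both norms are now powers of the same integral \<open>?I\<close>, and their
      exponents add up to 1.\<close>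
    unfolding L unfolding Lp_norm_def 1 2 ennreal_powr_add exps(3) ennreal_powr_1 ..
qed

end
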